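(* For any $M\ge 2$ and any $\epsilon>0$, there exists $k_0>0$ such that for any $k$ with $0<k\le k_0$, $$a(\mathbf{u},\mathbf{v})\le M\,|||\mathbf{u}|||\,|||\mathbf{v}|||\qquad\text{for all }\mathbf{u},\mathbf{v}\in H(\mathrm{div})\times L^2 ,$$ where both $a$ and $|||\cdot|||$ depend on $k$ and $\epsilon$.
   Context: Let $\Omega$ be an oriented two-dimensional (Riemannian) surface, for instance an open subset of $\mathbb{R}^2$. Write $(\cdot,\cdot)$ and $\|\cdot\|$ for the $L^2(\Omega)$ inner product and norm of (real) scalar functions or tangent vector fields. $L^2=L^2(\Omega)$, and $H(\mathrm{div})$ is the space of square-integrable tangent vector fields $u$ on $\Omega$ with weak divergence $\nabla\cdot u\in L^2$. For a vector field $u=(u_1,u_2)$, $u^\perp=(-u_2,u_1)$ is its pointwise rotation by $\pi/2$. Parameters: real constants $k>0$ (half the time step), $\epsilon>0$ (Rossby number), $\beta>0$ (Burger number). Coefficients: real measurable functions on $\Omega$: $H$ with $H(x)\ge H_*$ for a constant $H_*>0$ (depth); $f$ with $|f(x)|\le 1$ (Coriolis parameter); $C$ with $0\le C(x)\le C^*$ for a finite constant $C^*$ (damping). Here $\Omega,\beta,H,f,C$ are fixed. Bilinear form: for $\mathbf{u}=(u,\eta)$, $\mathbf{v}=(v,w)$ in $H(\mathrm{div})\times L^2$, $$a(\mathbf{u},\mathbf{v})=\left(\tfrac{1}{H}u,v\right)+\left(\tfrac{fk}{\epsilon H}u^\perp,v\right)-\tfrac{\beta k}{\epsilon^2}(\eta,\nabla\cdot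 v)+\left(\tfrac{Ck}{H}u,v\right)+\tfrac{\beta}{\epsilon^2}(\eta,w)+\tfrac{\beta k}{\epsilon^2}(\nabla\cdot u,w).$$ Weighted norm: $$|||\mathbf{u}|||^2=\left(\tfrac{1+Ck}{H}u,u\right)+\tfrac{k^2\beta}{\epsilon^2}\|\nabla\cdot u\|^2+\tfrac{\beta}{\epsilon^2}\|\eta\|^2 .$$ *)

theory Defs
  imports "HOL-Analysis.Analysis"
begin

section \<open>Smooth functions\<close>

text \<open>\<open>Ck_on n f A\<close>: on the open set \<open>A\<close> all iterated directional derivatives of \<open>f\<close>
  up to order \<open>n\<close> exist and are continuous.\<close>

primrec Ck_on :: "nat \<Rightarrow> ('a::real_normed_vector \<Rightarrow> 'b::real_normed_vector) \<Rightarrow> 'a set \<Rightarrow> bool" where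
  "Ck_on 0 f A \<longleftrightarrow> continuous_on A f"
| "Ck_on (Suc n) f A \<longleftrightarrow>
     (\<forall>x\<in>A. f differentiable (at x)) \<and>
     (\<forall>v. Ck_on n (\<lambda>x. frechet_derivative f (at x) v) A)"

definition smooth_on :: "('a::real_normed_vector \<Rightarrow> 'b::real_normed_vector) \<Rightarrow> 'a set \<Rightarrow> bool" where
  "smooth_on f A \<longleftrightarrow> (\<forall>n. Ck_on n f A)"


section \<open>Oriented two-dimensional Riemannian surfaces\<close>

text \<open>A surface comes with an indexed atlas. \<open>metric S i p\<close> is the Gram matrix of the metric
  at \<open>p\<close> in the coordinates of chart \<open>i\<close>; \<open>area S\<close> is the Riemannian area measure on the
  Borel sets. The values of \<open>coord S i\<close> and \<open>metric S i\<close> outside \<open>chart_dom S i\<close> play no role.\<close>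

record ('p, 'i) surface =
  surf_top :: "'p topology"
  charts :: "'i set"
  chart_dom :: "'i \<Rightarrow> 'p set"
  coord :: "'i \<Rightarrow> 'p \<Rightarrow> real^2"
  metric :: "'i \<Rightarrow> 'p \<Rightarrow> real^2^2"
  area :: "'p measure"

abbreviation points :: "('p, 'i) surface \<Rightarrow> 'p set" where
  "points S \<equiv> topspace (surf_top S)"

definition chart_inv :: "('p, 'i) surface \<Rightarrow> 'i \<Rightarrow> real^2 \<Rightarrow> 'p" where
  "chart_inv S i = the_inv_into (chart_dom S i) (coord S i)"

definition transition :: "('p, 'i) surface \<Rightarrow> 'i \<Rightarrow> 'i \<Rightarrow> real^2 \<Rightarrow> real^2" where
  "transition S i j = coord S j \<circ> chart_inv S i"

definition trans_jac :: "('p, 'i) surface \<Rightarrow> 'i \<Rightarrow> 'i \<Rightarrow> 'p \<Rightarrow> real^2^2" where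
  "trans_jac S i j p = jacobian (transition S i j) (at (coord S i p))"

definition oriented_smooth_atlas :: "('p, 'i) surface \<Rightarrow> bool" where
  "oriented_smooth_atlas S \<longleftrightarrow>
     (\<Union>i\<in>charts S. chart_dom S i) = points S \<and>
     (\<forall>i\<in>charts S.
        openin (surf_top S) (chart_dom S i) \<and>
        open (coord S i ` chart_dom S i) \<and>
        homeomorphic_map (subtopology (surf_top S) (chart_dom S i))
          (top_of_set (coord S i ` chart_dom S i)) (coord S i)) \<and>
     (\<forall>i\<in>charts S. \<forall>j\<in>charts S.
        smooth_on (transition S i j) (coord S i ` (chart_dom S i \<inter> chart_dom S j)) \<and>
        (\<forall>p\<in>chart_dom S i \<inter> chart_dom S j. det (trans_jac S i j p) > 0))"

definition riemannian_metric :: "('p, 'i) surface \<Rightarrow> bool" where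
  "riemannian_metric S \<longleftrightarrow>
     (\<forall>i\<in>charts S.
        smooth_on (\<lambda>x. metric S i (chart_inv S i x)) (coord S i ` chart_dom S i) \<and>
        (\<forall>p\<in>chart_dom S i.
           transpose (metric S i p) = metric S i p \<and>
           (\<forall>\<xi>. \<xi> \<noteq> 0 \<longrightarrow> \<xi> \<bullet> (metric S i p *v \<xi>) > 0))) \<and>
     (\<forall>i\<in>charts S. \<forall>j\<in>charts S. \<forall>p\<in>chart_dom S i \<inter> chart_dom S j.
        metric S i p = transpose (trans_jac S i j p) ** metric S j p ** trans_jac S i j p)"

text \<open>The area measure is determined by its values on Borel subsets of chart domains, since
  countably many chart domains cover a second countable surface.\<close>

definition riemannian_area :: "('p, 'i) surface \<Rightarrow> bool" where
  "riemannian_area S \<longleftrightarrow>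
     sets (area S) = sigma_sets (points S) {V. openin (surf_top S) V} \<and>
     (\<forall>i\<in>charts S. \<forall>B\<in>sets (area S). B \<subseteq> chart_dom S i \<longrightarrow>
        emeasure (area S) B =
          (\<integral>\<^sup>+x\<in>coord S i ` B. ennreal (sqrt (det (metric S i (chart_inv S i x)))) \<partial>lborel))"

definition oriented_riemannian_surface :: "('p, 'i) surface \<Rightarrow> bool" where
  "oriented_riemannian_surface S \<longleftrightarrow>
     Hausdorff_space (surf_top S) \<and> second_countable (surf_top S) \<and>
     oriented_smooth_atlas S \<and> riemannian_metric S \<and> riemannian_area S"


section \<open>Tangent vectors\<close>

text \<open>A tangent vector at \<open>p\<close> is the family of its coordinate vectors in all charts around
  \<open>p\<close>, related by the transformation law (and extended by 0 to the remaining indices).\<close>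

definition tangent_space :: "('p, 'i) surface \<Rightarrow> 'p \<Rightarrow> ('i \<Rightarrow> real^2) set" where
  "tangent_space S p =
     {\<xi>. (\<forall>i\<in>charts S. \<forall>j\<in>charts S. p \<in> chart_dom S i \<inter> chart_dom S j \<longrightarrow>
            \<xi> j = trans_jac S i j p *v \<xi> i) \<and>
          (\<forall>i. \<not> (i \<in> charts S \<and> p \<in> chart_dom S i) \<longrightarrow> \<xi> i = 0)}"

text \<open>\<open>tinner\<close> and \<open>differential\<close> below do not depend on the chart selected here.\<close>

definition chart_at :: "('p, 'i) surface \<Rightarrow> 'p \<Rightarrow> 'i" where
  "chart_at S p = (SOME i. i \<in> charts S \<and> p \<in> chart_dom S i)"

definition tinner :: "('p, 'i) surface \<Rightarrow> 'p \<Rightarrow> ('i \<Rightarrow> real^2) \<Rightarrow> ('i \<Rightarrow> real^2) \<Rightarrow> real" where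
  "tinner S p \<xi> \<zeta> = (let i = chart_at S p in \<xi> i \<bullet> (metric S i p *v \<zeta> i))"

text \<open>Rotation by \<open>\<pi>/2\<close> in the tangent plane: in a positively oriented chart with Gram matrix
  \<open>G\<close> it is \<open>\<xi> \<mapsto> (- (G \<xi>)\<^sub>2, (G \<xi>)\<^sub>1) / sqrt (det G)\<close>, which for \<open>G = 1\<close> is
  \<open>(- \<xi>\<^sub>2, \<xi>\<^sub>1)\<close>. Lemma \<open>rot_coords\<close> verifies that the result is orthogonal
  to \<open>\<xi>\<close>, of the same length, and positively oriented with respect to \<open>\<xi>\<close>.\<close>

definition rot_coords :: "real^2^2 \<Rightarrow> real^2 \<Rightarrow> real^2" where
  "rot_coords G \<xi> = (1 / sqrt (det G)) *\<^sub>R vector [- (G *v \<xi>) $ 2, (G *v \<xi>) $ 1]"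

definition perp :: "('p, 'i) surface \<Rightarrow> ('p \<Rightarrow> 'i \<Rightarrow> real^2) \<Rightarrow> 'p \<Rightarrow> 'i \<Rightarrow> real^2" where
  "perp S u p i =
     (if i \<in> charts S \<and> p \<in> chart_dom S i then rot_coords (metric S i p) (u p i) else 0)"

definition vscale :: "('p \<Rightarrow> real) \<Rightarrow> ('p \<Rightarrow> 'i \<Rightarrow> real^2) \<Rightarrow> 'p \<Rightarrow> 'i \<Rightarrow> real^2" where
  "vscale h u p i = h p *\<^sub>R u p i"


section \<open>Square-integrable functions and vector fields, weak divergence\<close>

text \<open>Functions are measurable with respect to the completed area measure (Lebesgue
  measurable); \<open>L\<^sup>2\<close> elements are represented by functions, not by classes modulo null sets.\<close>

definition leb :: "('p, 'i) surface \<Rightarrow> 'p measure" where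
  "leb S = completion (area S)"

definition L2 :: "('p, 'i) surface \<Rightarrow> ('p \<Rightarrow> real) set" where
  "L2 S = {h. h \<in> borel_measurable (leb S) \<and> integrable (leb S) (\<lambda>p. (h p)\<^sup>2)}"

definition L2_inner :: "('p, 'i) surface \<Rightarrow> ('p \<Rightarrow> real) \<Rightarrow> ('p \<Rightarrow> real) \<Rightarrow> real" where
  "L2_inner S h w = (\<integral>p. h p * w p \<partial>leb S)"

definition L2_norm :: "('p, 'i) surface \<Rightarrow> ('p \<Rightarrow> real) \<Rightarrow> real" where
  "L2_norm S h = sqrt (L2_inner S h h)"

definition vL2 :: "('p, 'i) surface \<Rightarrow> ('p \<Rightarrow> 'i \<Rightarrow> real^2) set" where
  "vL2 S = {u. (\<forall>p\<in>points S. u p \<in> tangent_space S p) \<and>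
     (\<forall>i\<in>charts S. (\<lambda>p. u p i) \<in> borel_measurable (restrict_space (leb S) (chart_dom S i))) \<and>
     integrable (leb S) (\<lambda>p. tinner S p (u p) (u p))}"

definition vL2_inner ::
    "('p, 'i) surface \<Rightarrow> ('p \<Rightarrow> 'i \<Rightarrow> real^2) \<Rightarrow> ('p \<Rightarrow> 'i \<Rightarrow> real^2) \<Rightarrow> real" where
  "vL2_inner S u v = (\<integral>p. tinner S p (u p) (v p) \<partial>leb S)"

definition test_functions :: "('p, 'i) surface \<Rightarrow> ('p \<Rightarrow> real) set" where
  "test_functions S =
     {\<psi>. (\<forall>i\<in>charts S. smooth_on (\<lambda>x. \<psi> (chart_inv S i x)) (coord S i ` chart_dom S i)) \<and>
          (\<exists>K. compactin (surf_top S) K \<and> (\<forall>p\<in>points S - K. \<psi> p = 0))}"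

definition differential :: "('p, 'i) surface \<Rightarrow> ('p \<Rightarrow> real) \<Rightarrow> 'p \<Rightarrow> ('i \<Rightarrow> real^2) \<Rightarrow> real" where
  "differential S \<psi> p \<xi> =
     (let i = chart_at S p in
      frechet_derivative (\<lambda>x. \<psi> (chart_inv S i x)) (at (coord S i p)) (\<xi> i))"

definition weak_divergence ::
    "('p, 'i) surface \<Rightarrow> ('p \<Rightarrow> 'i \<Rightarrow> real^2) \<Rightarrow> ('p \<Rightarrow> real) \<Rightarrow> bool" where
  "weak_divergence S u d \<longleftrightarrow>
     (\<forall>\<psi>\<in>test_functions S.
        (\<integral>p. differential S \<psi> p (u p) \<partial>leb S) = - (\<integral>p. d p * \<psi> p \<partial>leb S))"

definition Hdiv :: "('p, 'i) surface \<Rightarrow> ('p \<Rightarrow> 'i \<Rightarrow> real^2) set" where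
  "Hdiv S = {u\<in>vL2 S. \<exists>d\<in>L2 S. weak_divergence S u d}"

text \<open>The weak divergence is unique up to null sets; \<open>divg\<close> selects a representative.\<close>

definition divg :: "('p, 'i) surface \<Rightarrow> ('p \<Rightarrow> 'i \<Rightarrow> real^2) \<Rightarrow> 'p \<Rightarrow> real" where
  "divg S u = (SOME d. d \<in> L2 S \<and> weak_divergence S u d)"


section \<open>The bilinear form and the weighted norm\<close>

fun bilin_form :: "('p, 'i) surface \<Rightarrow> real \<Rightarrow> ('p \<Rightarrow> real) \<Rightarrow> ('p \<Rightarrow> real) \<Rightarrow> ('p \<Rightarrow> real) \<Rightarrow>
    real \<Rightarrow> real \<Rightarrow>
    ('p \<Rightarrow> 'i \<Rightarrow> real^2) \<times> ('p \<Rightarrow> real) \<Rightarrow> ('p \<Rightarrow> 'i \<Rightarrow> real^2) \<times> ('p \<Rightarrow> real) \<Rightarrow> real" where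
  "bilin_form S \<beta> H f C \<epsilon> k (u, \<eta>) (v, w) =
     vL2_inner S (vscale (\<lambda>p. 1 / H p) u) v
     + vL2_inner S (vscale (\<lambda>p. f p * k / (\<epsilon> * H p)) (perp S u)) v
     - \<beta> * k / \<epsilon>\<^sup>2 * L2_inner S \<eta> (divg S v)
     + vL2_inner S (vscale (\<lambda>p. C p * k / H p) u) v
     + \<beta> / \<epsilon>\<^sup>2 * L2_inner S \<eta> w
     + \<beta> * k / \<epsilon>\<^sup>2 * L2_inner S (divg S u) w"

fun weighted_norm :: "('p, 'i) surface \<Rightarrow> real \<Rightarrow> ('p \<Rightarrow> real) \<Rightarrow> ('p \<Rightarrow> real) \<Rightarrow> real \<Rightarrow> real \<Rightarrow>
    ('p \<Rightarrow> 'i \<Rightarrow> real^2) \<times> ('p \<Rightarrow> real) \<Rightarrow> real" where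
  "weighted_norm S \<beta> H C \<epsilon> k (u, \<eta>) =
     sqrt (vL2_inner S (vscale (\<lambda>p. (1 + C p * k) / H p) u) u
           + k\<^sup>2 * \<beta> / \<epsilon>\<^sup>2 * (L2_norm S (divg S u))\<^sup>2
           + \<beta> / \<epsilon>\<^sup>2 * (L2_norm S \<eta>)\<^sup>2)"


section \<open>Sanity checks\<close>

lemma rot_coords:
  assumes sym: "transpose G = G" and pos: "\<And>\<xi>. \<xi> \<noteq> 0 \<Longrightarrow> \<xi> \<bullet> (G *v \<xi>) > 0"
  shows "\<xi> \<bullet> (G *v rot_coords G \<xi>) = 0"
    and "rot_coords G \<xi> \<bullet> (G *v rot_coords G \<xi>) = \<xi> \<bullet> (G *v \<xi>)"
    and "\<xi> \<noteq> 0 \<Longrightarrow> \<xi> $ 1 * rot_coords G \<xi> $ 2 - \<xi> $ 2 * rot_coords G \<xi> $ 1 > 0"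
proof -
  define a b c where "a = G $ 1 $ 1" and "b = G $ 1 $ 2" and "c = G $ 2 $ 2"
  define x y where "x = \<xi> $ 1" and "y = \<xi> $ 2"
  have s: "G $ 2 $ 1 = b"
    using arg_cong[OF sym, of "\<lambda>A. A $ 1 $ 2"] by (simp add: transpose_def b_def)
  have d: "det G = a * c - b * b"
    by (simp add: det_2 a_def b_def c_def s)
  have a: "a > 0"
    using pos[of "vector [1, 0]"]
    by (simp add: a_def inner_vec_def matrix_vector_mult_def sum_2 vec_eq_iff forall_2)
  have "vector [- b, a] \<noteq> (0::real^2)"
    using a by (auto simp: vec_eq_iff forall_2)
  from pos[OF this] have "a * (a * c - b * b) > 0"
    by (simp add: inner_vec_def matrix_vector_mult_def sum_2 a_def[symmetric] b_def[symmetric]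
        c_def[symmetric] s algebra_simps)
  with a have dpos: "det G > 0"
    by (simp add: d zero_less_mult_iff)
  define r where "r = 1 / sqrt (det G)"
  have r: "r > 0" "r * r * (a * c - b * b) = 1"
    using dpos unfolding r_def d by simp_all
  have G1: "(G *v \<zeta>) $ 1 = a * \<zeta> $ 1 + b * \<zeta> $ 2" and G2: "(G *v \<zeta>) $ 2 = b * \<zeta> $ 1 + c * \<zeta> $ 2" for \<zeta>
    by (simp_all add: matrix_vector_mult_def sum_2 a_def b_def c_def s)
  have R1: "rot_coords G \<xi> $ 1 = - r * (b * x + c * y)" and R2: "rot_coords G \<xi> $ 2 = r * (a * x + b * y)"
    unfolding rot_coords_def r_def[symmetric] by (simp_all add: G1 G2 x_def y_def algebra_simps)
  show "\<xi> \<bullet> (G *v rot_coords G \<xi>) = 0"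
    by (simp add: inner_vec_def sum_2 G1 G2 R1 R2 x_def[symmetric] y_def[symmetric] algebra_simps)
  have "rot_coords G \<xi> \<bullet> (G *v rot_coords G \<xi>) =
      (r * r * (a * c - b * b)) * (a * x * x + 2 * b * x * y + c * y * y)"
    by (simp add: inner_vec_def sum_2 G1 G2 R1 R2 algebra_simps)
  also have "\<dots> = \<xi> \<bullet> (G *v \<xi>)"
    unfolding r(2) by (simp add: inner_vec_def sum_2 G1 G2 x_def y_def algebra_simps)
  finally show "rot_coords G \<xi> \<bullet> (G *v rot_coords G \<xi>) = \<xi> \<bullet> (G *v \<xi>)" .
  assume "\<xi> \<noteq> 0"
  have "\<xi> $ 1 * rot_coords G \<xi> $ 2 - \<xi> $ 2 * rot_coords G \<xi> $ 1 = r * (\<xi> \<bullet> (G *v \<xi>))"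
    by (simp add: inner_vec_def sum_2 G1 G2 R1 R2 x_def y_def algebra_simps)
  with pos[OF \<open>\<xi> \<noteq> 0\<close>] r(1) show "\<xi> $ 1 * rot_coords G \<xi> $ 2 - \<xi> $ 2 * rot_coords G \<xi> $ 1 > 0"
    by simp
qed

definition planar :: "(real^2) set \<Rightarrow> (real^2, unit) surface" where
  "planar \<Omega> = \<lparr>surf_top = top_of_set \<Omega>, charts = {()}, chart_dom = (\<lambda>_. \<Omega>),
     coord = (\<lambda>_ p. p), metric = (\<lambda>_ _. mat 1), area = restrict_space lborel \<Omega>\<rparr>"

lemma Ck_on_cong:
  "open A \<Longrightarrow> (\<And>x. x \<in> A \<Longrightarrow> f x = g x) \<Longrightarrow> Ck_on n f A \<Longrightarrow> Ck_on n g A"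
proof (induction n arbitrary: f g)
  case 0
  then show ?case by (simp cong: continuous_on_cong)
next
  case (Suc n)
  have gd: "(g has_derivative frechet_derivative f (at x)) (at x)" if "x \<in> A" for x
  proof (rule has_derivative_transform_within_open[OF _ Suc.prems(1) that Suc.prems(2)])
    show "(f has_derivative frechet_derivative f (at x)) (at x)"
      using Suc.prems(3) that by (auto simp: frechet_derivative_works)
  qed
  have eq: "frechet_derivative g (at x) = frechet_derivative f (at x)" if "x \<in> A" for x
    using frechet_derivative_at[OF gd[OF that]] by simp
  have "Ck_on n (\<lambda>x. frechet_derivative g (at x) v) A" for v
    by (rule Suc.IH[of "\<lambda>x. frechet_derivative f (at x) v"]) (use Suc.prems eq in auto)
  then show ?case
    using gd by (auto simp: differentiable_def)
qed

lemma smooth_on_const: "smooth_on (\<lambda>_. c) A"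
proof -
  have "Ck_on n (\<lambda>_. c) A" for n
    by (induction n arbitrary: c) auto
  then show ?thesis by (simp add: smooth_on_def)
qed

lemma smooth_on_ident: "smooth_on (\<lambda>x. x) A"
  unfolding smooth_on_def
proof
  fix n show "Ck_on n (\<lambda>x. x) A"
    using smooth_on_const by (cases n) (auto simp: smooth_on_def)
qed

lemma oriented_riemannian_surface_planar:
  assumes "open \<Omega>"
  shows "oriented_riemannian_surface (planar \<Omega>)"
proof -
  have inv: "chart_inv (planar \<Omega>) i x = x" if "x \<in> \<Omega>" for i x
    using that by (auto simp: chart_inv_def planar_def the_inv_into_f_f[of "\<lambda>x. x"])
  have tr: "transition (planar \<Omega>) i j x = x" if "x \<in> \<Omega>" for i j x
    using inv[OF that, of i] by (simp add: transition_def) (simp add: planar_def)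
  have jac: "trans_jac (planar \<Omega>) i j p = mat 1" if "p \<in> \<Omega>" for i j p
  proof -
    have "(transition (planar \<Omega>) i j has_derivative (\<lambda>h. h)) (at p)"
      by (rule has_derivative_transform_within_open[OF has_derivative_ident assms that])
         (simp add: tr)
    then show ?thesis
      unfolding trans_jac_def jacobian_def
      by (simp add: frechet_derivative_at[symmetric] planar_def matrix_def mat_def axis_def vec_eq_iff)
  qed
  have "smooth_on (transition (planar \<Omega>) i j) \<Omega>" for i j
    using smooth_on_ident[of \<Omega>] Ck_on_cong[OF assms, of "\<lambda>x. x" "transition (planar \<Omega>) i j"] tr
    by (auto simp: smooth_on_def)
  then have "oriented_smooth_atlas (planar \<Omega>)"
    using assms jac
    by (auto simp: oriented_smooth_atlas_def) (auto simp: planar_def subtopology_subtopology homeomorphic_map_id[unfolded id_def])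
  moreover have "riemannian_metric (planar \<Omega>)"
    using jac by (auto simp: riemannian_metric_def) (auto simp: planar_def smooth_on_const transpose_mat)
  moreover have "riemannian_area (planar \<Omega>)"
  proof -
    have "sets (restrict_space lborel \<Omega>) = sigma_sets \<Omega> ((\<inter>) \<Omega> ` {V. open V})"
      by (simp add: sets_restrict_space borel_def sigma_sets_Int sigma_sets.Basic assms)
    also have "(\<inter>) \<Omega> ` {V. open V} = {V. openin (top_of_set \<Omega>) V}"
      by (auto simp: openin_open)
    finally have *: "sets (restrict_space lborel \<Omega>) = sigma_sets \<Omega> {V. openin (top_of_set \<Omega>) V}" .
    have "emeasure (restrict_space lborel \<Omega>) B = (\<integral>\<^sup>+x\<in>B. 1 \<partial>lborel)"
      if "B \<in> sets (restrict_space lborel \<Omega>)" for B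
      using that assms by (auto simp: emeasure_restrict_space sets_restrict_space_iff)
    then show ?thesis
      using * by (auto simp: riemannian_area_def) (auto simp: planar_def)
  qed
  moreover have "second_countable (top_of_set \<Omega>)"
  proof (rule second_countable_subtopology)
    obtain \<B> :: "(real^2) set set" where \<B>: "countable \<B>" "topological_basis \<B>"
      using ex_countable_basis by blast
    then have "\<forall>V\<in>\<B>. open V"
      by (simp add: topological_basis_open)
    moreover have "\<exists>V\<in>\<B>. x \<in> V \<and> V \<subseteq> U" if "open U" "x \<in> U" for U x
      using topological_basisE[OF \<B>(2) that] by metis
    ultimately show "second_countable (euclidean :: (real^2) topology)"
      unfolding second_countable_def using \<B>(1) by (metis open_openin)
  qed
  ultimately show ?thesis
    by (simp add: oriented_riemannian_surface_def)
       (simp add: planar_def Hausdorff_space_subtopology)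
qed

lemma planar_simps:
  assumes "p \<in> \<Omega>"
  shows "tinner (planar \<Omega>) p \<xi> \<zeta> = \<xi> () \<bullet> \<zeta> ()"
    and "perp (planar \<Omega>) u p () = vector [- (u p () $ 2), u p () $ 1]"
  using assms by (simp_all add: tinner_def perp_def rot_coords_def planar_def)

end

theory Submission
  imports Defs
begin

text \<open>Write \<open>A\<close>, \<open>D\<close>, \<open>E\<close> for the square roots of the three terms of the squared weighted norm of
  \<open>U\<close>, and \<open>A'\<close>, \<open>D'\<close>, \<open>E'\<close> for those of \<open>V\<close>. Applying the Cauchy-Schwarz inequality termwise,
  and using that rotation is an isometry,
  \<open>a(U, V) \<le> (1 + k/\<epsilon>) A A' + E D' + E E' + D E' \<le> (1 + k/\<epsilon>) A A' + (D + E) (D' + E')\<close>.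
  For \<open>k \<le> \<epsilon>\<close> this is at most \<open>2 |||U||| |||V|||\<close>, since \<open>(D + E)\<^sup>2 \<le> 2 (D\<^sup>2 + E\<^sup>2)\<close>.
  So \<open>k\<^sub>0 = \<epsilon>\<close> works.\<close>

section \<open>Cauchy-Schwarz inequalities in the plane and for integrals\<close>

lemma mult_le_sqrt_mult_sqrt:
  fixes a b c d :: real
  shows "a * c + b * d \<le> sqrt (a\<^sup>2 + b\<^sup>2) * sqrt (c\<^sup>2 + d\<^sup>2)"
  using norm_cauchy_schwarz[of "(a, b)" "(c, d)"] by (simp add: norm_Pair)

text \<open>If \<open>\<phi>\<close> is not measurable, its Bochner integral is 0. This spares us the measurability of
  inner products of vector fields, which are given as measurable only chart by chart.\<close>

lemma abs_integral_le_sqrt_mult: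
  fixes \<phi> a b :: "'a \<Rightarrow> real"
  assumes a: "integrable M a" and b: "integrable M b"
    and a0: "\<And>x. x \<in> space M \<Longrightarrow> 0 \<le> a x" and b0: "\<And>x. x \<in> space M \<Longrightarrow> 0 \<le> b x"
    and le: "\<And>x. x \<in> space M \<Longrightarrow> (\<phi> x)\<^sup>2 \<le> a x * b x"
  shows "\<bar>\<integral>x. \<phi> x \<partial>M\<bar> \<le> sqrt (\<integral>x. a x \<partial>M) * sqrt (\<integral>x. b x \<partial>M)"
proof -
  define I A B where "I = (\<integral>x. \<phi> x \<partial>M)" and "A = (\<integral>x. a x \<partial>M)" and "B = (\<integral>x. b x \<partial>M)"
  have A0: "0 \<le> A" and B0: "0 \<le> B"
    unfolding A_def B_def using a0 b0 by (auto intro!: integral_nonneg_AE AE_I2)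
  \<comment> \<open>Discriminant argument: integrating the pointwise AM-GM bound \<open>pt\<close>
    gives a quadratic in \<open>t\<close> that is nonnegative everywhere.\<close>
  have quad: "0 \<le> t\<^sup>2 * A + 2 * t * I + B" for t
  proof -
    have pt: "- 2 * t * \<phi> x \<le> t\<^sup>2 * a x + b x" if "x \<in> space M" for x
    proof (rule power2_le_imp_le)
      have "(- 2 * t * \<phi> x)\<^sup>2 \<le> 4 * t\<^sup>2 * (a x * b x)"
        using mult_left_mono[OF le[OF that], of "4 * t\<^sup>2"] by (simp add: power_mult_distrib)
      also have "\<dots> \<le> (t\<^sup>2 * a x + b x)\<^sup>2"
        using zero_le_power2[of "t\<^sup>2 * a x - b x"] by (simp add: power2_eq_square algebra_simps)
      finally show "(- 2 * t * \<phi> x)\<^sup>2 \<le> (t\<^sup>2 * a x + b x)\<^sup>2" .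
    qed (use a0 b0 that in simp)
    \<comment> \<open>\<open>integral_mono'\<close> asks for integrability of the nonnegative
      majorant only: if the left integrand is not integrable, its integral is 0.\<close>
    have "(\<integral>x. - 2 * t * \<phi> x \<partial>M) \<le> (\<integral>x. t\<^sup>2 * a x + b x \<partial>M)"
      by (rule integral_mono') (use a b a0 b0 pt in auto)
    then show ?thesis
      unfolding I_def A_def B_def using a b by simp
  qed
  have "I\<^sup>2 \<le> A * B"
  proof (cases "A = 0")
    case True
    have "I = 0"
    proof (rule ccontr)
      assume "I \<noteq> 0"
      \<comment> \<open>For \<open>A = 0\<close> the quadratic is affine in \<open>t\<close>; this
        \<open>t\<close> gives it the value -1.\<close>
      with quad[of "- (B + 1) / (2 * I)"] True show False by (simp add: field_simps)
    qed
    with True show ?thesis by simp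
  next
    case False
    \<comment> \<open>The minimiser of the quadratic, where its value is
      \<open>B - I\<^sup>2 / A\<close>.\<close>
    with A0 quad[of "- I / A"] show ?thesis
      by (simp add: power2_eq_square field_simps)
  qed
  then have "\<bar>I\<bar> \<le> sqrt (A * B)"
    by (metis real_sqrt_abs real_sqrt_le_mono)
  then show ?thesis
    unfolding I_def A_def B_def by (simp add: real_sqrt_mult)
qed

section \<open>Pointwise geometry of the tangent planes\<close>

text \<open>\<open>riemannian_area\<close> prescribes the sigma-algebra of \<open>area S\<close>,
  which determines its space. This links hypotheses on \<open>points S\<close> to integrals over
  \<open>leb S\<close>.\<close>

lemma space_leb:
  assumes "oriented_riemannian_surface S"
  shows "space (leb S) = points S"
proof -
  have s: "sets (area S) = sigma_sets (points S) {V. openin (surf_top S) V}"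
    using assms by (simp add: oriented_riemannian_surface_def riemannian_area_def)
  have "{V. openin (surf_top S) V} \<subseteq> Pow (points S)"
    using openin_subset by blast
  then have "sets (area S) = sets (sigma (points S) {V. openin (surf_top S) V})"
    using s by simp
  from sets_eq_imp_space_eq[OF this] have "space (area S) = points S"
    by (simp add: space_measure_of_conv)
  then show ?thesis by (simp add: leb_def)
qed

lemma chart_at_mem:
  assumes "oriented_riemannian_surface S" "p \<in> points S"
  shows "chart_at S p \<in> charts S" "p \<in> chart_dom S (chart_at S p)"
proof -
  have "\<exists>i. i \<in> charts S \<and> p \<in> chart_dom S i"
    using assms by (auto simp: oriented_riemannian_surface_def oriented_smooth_atlas_def)
  from someI_ex[OF this] show "chart_at S p \<in> charts S" "p \<in> chart_dom S (chart_at S p)"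
    by (auto simp: chart_at_def)
qed

lemma metric_chart_at:
  assumes "oriented_riemannian_surface S" "p \<in> points S"
  defines "G \<equiv> metric S (chart_at S p) p"
  shows "transpose G = G" "\<And>\<xi>. \<xi> \<noteq> 0 \<Longrightarrow> \<xi> \<bullet> (G *v \<xi>) > 0"
  using assms(1) chart_at_mem[OF assms(1,2)]
  unfolding G_def oriented_riemannian_surface_def riemannian_metric_def by blast+

text \<open>The form is nonnegative at \<open>c *\<^sub>R x - b *\<^sub>R y\<close>, which is
  \<open>c\<close> times the part of \<open>x\<close> that is \<open>G\<close>-orthogonal to
  \<open>y\<close>; the value there is \<open>c\<close> times the difference of the two
  sides.\<close>

lemma cauchy_schwarz_matrix:
  fixes G :: "real^'n^'n"
  assumes sym: "transpose G = G" and pos: "\<And>\<xi>. \<xi> \<noteq> 0 \<Longrightarrow> \<xi> \<bullet> (G *v \<xi>) > 0"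
  shows "(x \<bullet> (G *v y))\<^sup>2 \<le> (x \<bullet> (G *v x)) * (y \<bullet> (G *v y))"
proof (cases "y = 0")
  case False
  define b c where "b = x \<bullet> (G *v y)" and "c = y \<bullet> (G *v y)"
  have yx: "y \<bullet> (G *v x) = b"
    unfolding b_def by (metis dot_lmul_matrix inner_commute sym transpose_matrix_vector)
  have c: "c > 0" using pos[OF False] by (simp add: c_def)
  define z where "z = c *\<^sub>R x - b *\<^sub>R y"
  have "0 \<le> z \<bullet> (G *v z)"
    using pos[of z] by (cases "z = 0") auto
  also have "z \<bullet> (G *v z) = c * (c * (x \<bullet> (G *v x)) - b\<^sup>2)"
    using yx by (simp add: z_def matrix_vector_mult_diff_distrib matrix_vector_mult_scaleR
        inner_diff_left inner_diff_right b_def[symmetric] c_def[symmetric]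
        power2_eq_square algebra_simps)
  finally show ?thesis
    using c by (simp add: zero_le_mult_iff b_def c_def mult.commute)
qed simp

lemma tinner_nonneg:
  assumes "oriented_riemannian_surface S" "p \<in> points S"
  shows "0 \<le> tinner S p \<xi> \<xi>"
  using metric_chart_at(2)[OF assms, of "\<xi> (chart_at S p)"]
  by (cases "\<xi> (chart_at S p) = 0") (auto simp: tinner_def Let_def)

lemma tinner_cauchy_schwarz:
  assumes "oriented_riemannian_surface S" "p \<in> points S"
  shows "(tinner S p \<xi> \<zeta>)\<^sup>2 \<le> tinner S p \<xi> \<xi> * tinner S p \<zeta> \<zeta>"
  unfolding tinner_def Let_def
  by (rule cauchy_schwarz_matrix[OF metric_chart_at[OF assms]])

lemma tinner_perp_perp:
  assumes "oriented_riemannian_surface S" "p \<in> points S"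
  shows "tinner S p (perp S u p) (perp S u p) = tinner S p (u p) (u p)"
  using rot_coords(2)[OF metric_chart_at[OF assms]] chart_at_mem[OF assms]
  by (simp add: tinner_def Let_def perp_def)

lemma tinner_vscale_left: "tinner S p (vscale h u p) \<zeta> = h p * tinner S p (u p) \<zeta>"
  by (simp add: tinner_def Let_def vscale_def)

section \<open>Weighted Cauchy-Schwarz inequalities for fields and functions\<close>

text \<open>Serves the weights 1/H and Ck/H. Measurability of the squared length comes from its
  integrability, which is part of \<open>vL2\<close>.\<close>

lemma integrable_weighted_tinner:
  assumes S: "oriented_riemannian_surface S" and u: "u \<in> vL2 S"
    and h: "h \<in> borel_measurable (leb S)" and bd: "\<And>p. p \<in> points S \<Longrightarrow> \<bar>h p\<bar> \<le> B"
  shows "integrable (leb S) (\<lambda>p. h p * tinner S p (u p) (u p))"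
proof (rule Bochner_Integration.integrable_bound)
  have int: "integrable (leb S) (\<lambda>p. tinner S p (u p) (u p))"
    using u by (simp add: vL2_def)
  then show "integrable (leb S) (\<lambda>p. B * tinner S p (u p) (u p))"
    by simp
  show "(\<lambda>p. h p * tinner S p (u p) (u p)) \<in> borel_measurable (leb S)"
    using h int by (intro borel_measurable_times) auto
  show "AE p in leb S. norm (h p * tinner S p (u p) (u p)) \<le> norm (B * tinner S p (u p) (u p))"
    using bd S by (intro AE_I2) (force simp: space_leb[OF S] abs_mult intro: mult_right_mono)
qed

text \<open>One statement for all three velocity terms: \<open>g = h\<close> and
  \<open>u' = u\<close> for the mass and damping terms, and g = f/H, h = 1/H,
  \<open>u' = perp S u\<close> for the Coriolis term.\<close>

lemma abs_vL2_inner_le: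
  assumes S: "oriented_riemannian_surface S"
    and h0: "\<And>p. p \<in> points S \<Longrightarrow> 0 \<le> h p"
    and g: "\<And>p. p \<in> points S \<Longrightarrow> \<bar>g p\<bar> \<le> h p"
    and u': "\<And>p. p \<in> points S \<Longrightarrow> tinner S p (u' p) (u' p) = tinner S p (u p) (u p)"
    and u: "integrable (leb S) (\<lambda>p. h p * tinner S p (u p) (u p))"
    and v: "integrable (leb S) (\<lambda>p. h p * tinner S p (v p) (v p))"
  shows "\<bar>vL2_inner S (vscale g u') v\<bar>
    \<le> sqrt (vL2_inner S (vscale h u) u) * sqrt (vL2_inner S (vscale h v) v)"
  unfolding vL2_inner_def tinner_vscale_left
proof (rule abs_integral_le_sqrt_mult[OF u v], unfold space_leb[OF S])
  fix p assume p: "p \<in> points S"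
  show "0 \<le> h p * tinner S p (u p) (u p)" "0 \<le> h p * tinner S p (v p) (v p)"
    using h0[OF p] tinner_nonneg[OF S p] by simp_all
  have "(g p)\<^sup>2 \<le> (h p)\<^sup>2"
    using power_mono[OF g[OF p], of 2] by simp
  then have "(g p)\<^sup>2 * (tinner S p (u' p) (v p))\<^sup>2
      \<le> (h p)\<^sup>2 * (tinner S p (u' p) (u' p) * tinner S p (v p) (v p))"
    using tinner_cauchy_schwarz[OF S p] by (intro mult_mono) auto
  then show "(g p * tinner S p (u' p) (v p))\<^sup>2
      \<le> h p * tinner S p (u p) (u p) * (h p * tinner S p (v p) (v p))"
    by (simp add: u'[OF p] power2_eq_square ac_simps)
qed

lemma L2_inner_self_nonneg: "0 \<le> L2_inner S h h"
  by (simp add: L2_inner_def)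

lemma abs_L2_inner_le:
  assumes "h \<in> L2 S" "w \<in> L2 S"
  shows "\<bar>L2_inner S h w\<bar> \<le> L2_norm S h * L2_norm S w"
  unfolding L2_norm_def L2_inner_def
  by (rule abs_integral_le_sqrt_mult)
     (use assms in \<open>auto simp: L2_def power2_eq_square ac_simps\<close>)

lemma divg_L2:
  assumes "u \<in> Hdiv S"
  shows "divg S u \<in> L2 S"
proof -
  have "\<exists>d. d \<in> L2 S \<and> weak_divergence S u d"
    using assms by (auto simp: Hdiv_def)
  from someI_ex[OF this] show ?thesis
    by (simp add: divg_def)
qed

section \<open>Assembling the bound on the bilinear form\<close>

text \<open>The plane Cauchy-Schwarz inequality bounds \<open>a * a' + c * c'\<close> and
  \<open>r * (a * a')\<close> by \<open>X * X'\<close> each, and \<open>e * d' + d * e'\<close> and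
  \<open>e * e'\<close> by \<open>Y * Y'\<close> each. Both products thus occur twice, which gives
  the constant 2.\<close>

lemma combined_bound:
  fixes a c d e a' c' d' e' r :: real
  assumes "0 \<le> a" "0 \<le> c" "0 \<le> d" "0 \<le> e" "0 \<le> a'" "0 \<le> c'" "0 \<le> d'" "0 \<le> e'" "r \<le> 1"
  shows "a * a' + r * (a * a') + e * d' + c * c' + e * e' + d * e'
    \<le> 2 * sqrt (a\<^sup>2 + c\<^sup>2 + d\<^sup>2 + e\<^sup>2) * sqrt (a'\<^sup>2 + c'\<^sup>2 + d'\<^sup>2 + e'\<^sup>2)"
proof -
  define X Y where "X = sqrt (a\<^sup>2 + c\<^sup>2)" and "Y = sqrt (d\<^sup>2 + e\<^sup>2)"
  define X' Y' where "X' = sqrt (a'\<^sup>2 + c'\<^sup>2)" and "Y' = sqrt (d'\<^sup>2 + e'\<^sup>2)"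
  have sq: "X\<^sup>2 = a\<^sup>2 + c\<^sup>2" "Y\<^sup>2 = d\<^sup>2 + e\<^sup>2" "X'\<^sup>2 = a'\<^sup>2 + c'\<^sup>2" "Y'\<^sup>2 = d'\<^sup>2 + e'\<^sup>2"
    by (simp_all add: X_def Y_def X'_def Y'_def)
  have "r * (a * a') \<le> a * a'"
    using assms mult_right_mono[of r 1 "a * a'"] by simp
  moreover have "0 \<le> c * c'" "0 \<le> d * d'"
    using assms by simp_all
  moreover have "a * a' + c * c' \<le> X * X'"
    unfolding X_def X'_def by (rule mult_le_sqrt_mult_sqrt)
  moreover have "d * d' + e * e' \<le> Y * Y'" "d * e' + e * d' \<le> Y * Y'"
    unfolding Y_def Y'_def
    using mult_le_sqrt_mult_sqrt[of d d' e e'] mult_le_sqrt_mult_sqrt[of d e' e d']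
    by (simp_all add: add.commute)
  moreover have "X * X' + Y * Y' \<le> sqrt (X\<^sup>2 + Y\<^sup>2) * sqrt (X'\<^sup>2 + Y'\<^sup>2)"
    by (rule mult_le_sqrt_mult_sqrt)
  ultimately have "a * a' + r * (a * a') + e * d' + c * c' + e * e' + d * e'
      \<le> 2 * (sqrt (X\<^sup>2 + Y\<^sup>2) * sqrt (X'\<^sup>2 + Y'\<^sup>2))"
    by linarith
  then show ?thesis
    by (simp add: sq add.assoc)
qed

lemma bilin_form_le:
  fixes S :: "('p, 'i) surface"
  assumes S: "oriented_riemannian_surface S"
    and \<beta>: "\<beta> > 0" and k: "0 < k" "k \<le> \<epsilon>"
    and Hm: "H \<in> borel_measurable (leb S)" and Cm: "C \<in> borel_measurable (leb S)"
    and Hs: "H_star > 0" and H: "\<And>p. p \<in> points S \<Longrightarrow> H p \<ge> H_star"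
    and f: "\<And>p. p \<in> points S \<Longrightarrow> \<bar>f p\<bar> \<le> 1"
    and C: "\<And>p. p \<in> points S \<Longrightarrow> 0 \<le> C p \<and> C p \<le> C_star"
    and u: "u \<in> Hdiv S" and v: "v \<in> Hdiv S" and \<eta>: "\<eta> \<in> L2 S" and w: "w \<in> L2 S"
  shows "bilin_form S \<beta> H f C \<epsilon> k (u, \<eta>) (v, w)
    \<le> 2 * weighted_norm S \<beta> H C \<epsilon> k (u, \<eta>) * weighted_norm S \<beta> H C \<epsilon> k (v, w)"
proof -
  have eps: "\<epsilon> > 0" using k by simp
  have H0: "H p > 0" if "p \<in> points S" for p using H[OF that] Hs by simp
  have Hinv: "1 / H p \<le> 1 / H_star" if "p \<in> points S" for p
    using H[OF that] Hs by (simp add: frac_le)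
  have vL2: "u \<in> vL2 S" "v \<in> vL2 S" using u v by (auto simp: Hdiv_def)
  note inner_defs = vL2_inner_def tinner_vscale_left
  \<comment> \<open>With this square root the coefficients factor as \<open>s * s\<close> and
    \<open>s * (k * s)\<close>, one factor for each argument of the form.\<close>
  define s where "s = sqrt \<beta> / \<epsilon>"
  have s: "s > 0" "s * s = \<beta> / \<epsilon>\<^sup>2"
    using \<beta> eps by (simp_all add: s_def power2_eq_square)
  \<comment> \<open>The velocity term of the squared norm, with weight (1 + Ck)/H, is split into
    \<open>P\<close> squared plus \<open>Q\<close> squared, to match the separate mass and damping
    terms of the form.\<close>
  define P where "P x = sqrt (vL2_inner S (vscale (\<lambda>p. 1 / H p) x) x)" for x
  define Q where "Q x = sqrt (vL2_inner S (vscale (\<lambda>p. C p * k / H p) x) x)" for x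
  define D where "D x = k * s * L2_norm S (divg S x)" for x
  define E where "E y = s * L2_norm S y" for y
  have intP: "integrable (leb S) (\<lambda>p. 1 / H p * tinner S p (x p) (x p))" if "x \<in> vL2 S" for x
  proof (rule integrable_weighted_tinner[OF S that])
    show "(\<lambda>p. 1 / H p) \<in> borel_measurable (leb S)" using Hm by simp
    show "\<bar>1 / H p\<bar> \<le> 1 / H_star" if "p \<in> points S" for p
      using Hinv[OF that] H0[OF that] by simp
  qed
  have intQ: "integrable (leb S) (\<lambda>p. C p * k / H p * tinner S p (x p) (x p))"
    if "x \<in> vL2 S" for x
  proof (rule integrable_weighted_tinner[OF S that])
    show "(\<lambda>p. C p * k / H p) \<in> borel_measurable (leb S)" using Hm Cm by simp
    show "\<bar>C p * k / H p\<bar> \<le> C_star * k / H_star" if "p \<in> points S" for p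
      using C[OF that] H0[OF that] H[OF that] Hs k by (auto intro!: frac_le mult_right_mono)
  qed
  have nonneg: "0 \<le> vL2_inner S (vscale h x) x" if "\<And>p. p \<in> points S \<Longrightarrow> 0 \<le> h p" for h x
    unfolding inner_defs using that tinner_nonneg[OF S]
    by (intro integral_nonneg_AE AE_I2) (auto simp: space_leb[OF S])
  have hP: "0 \<le> 1 / H p" and hQ: "0 \<le> C p * k / H p" if "p \<in> points S" for p
    using H0[OF that] C[OF that] k by auto
  have P2: "(P x)\<^sup>2 = vL2_inner S (vscale (\<lambda>p. 1 / H p) x) x" for x
    unfolding P_def by (rule real_sqrt_pow2[OF nonneg[OF hP]])
  have Q2: "(Q x)\<^sup>2 = vL2_inner S (vscale (\<lambda>p. C p * k / H p) x) x" for x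
    unfolding Q_def by (rule real_sqrt_pow2[OF nonneg[OF hQ]])
  have P0: "0 \<le> P x" for x unfolding P_def by (rule real_sqrt_ge_zero[OF nonneg[OF hP]])
  have Q0: "0 \<le> Q x" for x unfolding Q_def by (rule real_sqrt_ge_zero[OF nonneg[OF hQ]])
  have L0: "0 \<le> L2_norm S y" for y by (simp add: L2_norm_def L2_inner_self_nonneg)
  have norm: "weighted_norm S \<beta> H C \<epsilon> k (x, y) = sqrt ((P x)\<^sup>2 + (Q x)\<^sup>2 + (D x)\<^sup>2 + (E y)\<^sup>2)"
    if "x \<in> vL2 S" for x y
  proof -
    have "vL2_inner S (vscale (\<lambda>p. (1 + C p * k) / H p) x) x = (P x)\<^sup>2 + (Q x)\<^sup>2"
      unfolding P2 Q2 inner_defs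
      \<comment> \<open>Splitting the integral needs both parts integrable, hence the bounds on H
        and C.\<close>
      using Bochner_Integration.integral_add[OF intP[OF that] intQ[OF that]]
      by (simp add: add_divide_distrib distrib_right)
    moreover have "k\<^sup>2 * \<beta> / \<epsilon>\<^sup>2 = (k * s)\<^sup>2" "\<beta> / \<epsilon>\<^sup>2 = s\<^sup>2"
      using s(2) by (simp_all add: power2_eq_square algebra_simps)
    ultimately show ?thesis
      by (simp add: D_def E_def power_mult_distrib)
  qed
  have "vL2_inner S (vscale (\<lambda>p. 1 / H p) u) v \<le> P u * P v"
    unfolding P_def
    by (rule order_trans[OF abs_ge_self abs_vL2_inner_le[OF S _ _ _ intP intP]])
       (use hP vL2 in \<open>simp_all only: abs_of_nonneg order_refl\<close>)
  moreover have "vL2_inner S (vscale (\<lambda>p. C p * k / H p) u) v \<le> Q u * Q v"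
    unfolding Q_def
    by (rule order_trans[OF abs_ge_self abs_vL2_inner_le[OF S _ _ _ intQ intQ]])
       (use hQ vL2 in \<open>simp_all only: abs_of_nonneg order_refl\<close>)
  moreover have "vL2_inner S (vscale (\<lambda>p. f p * k / (\<epsilon> * H p)) (perp S u)) v
      \<le> k / \<epsilon> * (P u * P v)"
  proof -
    \<comment> \<open>Once k/\<epsilon> is pulled out, the remaining weight f/H is dominated by 1/H
      because |f| is at most 1.\<close>
    have "vL2_inner S (vscale (\<lambda>p. f p * k / (\<epsilon> * H p)) (perp S u)) v
        = k / \<epsilon> * vL2_inner S (vscale (\<lambda>p. f p / H p) (perp S u)) v"
      unfolding inner_defs integral_mult_right_zero[symmetric]
      by (rule Bochner_Integration.integral_cong) (simp_all add: divide_inverse ac_simps)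
    moreover have "vL2_inner S (vscale (\<lambda>p. f p / H p) (perp S u)) v \<le> P u * P v"
      unfolding P_def
    proof (rule order_trans[OF abs_ge_self abs_vL2_inner_le[OF S _ _ _ intP intP]])
      show "\<bar>f p / H p\<bar> \<le> 1 / H p" if "p \<in> points S" for p
        using f[OF that] H0[OF that] by (simp add: abs_divide divide_right_mono)
    qed (use hP vL2 tinner_perp_perp[OF S] in auto)
    ultimately show ?thesis
      using k eps by (simp add: mult_left_mono divide_right_mono)
  qed
  \<comment> \<open>This term enters with a minus sign, so the lower bound contained in
    \<open>abs_L2_inner_le\<close> is used.\<close>
  moreover have "- (\<beta> * k / \<epsilon>\<^sup>2 * L2_inner S \<eta> (divg S v)) \<le> E \<eta> * D v"
  proof -
    have "- (\<beta> * k / \<epsilon>\<^sup>2 * L2_inner S \<eta> (divg S v)) = (s * s * k) * - L2_inner S \<eta> (divg S v)"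
      by (simp add: s(2))
    also have "\<dots> \<le> (s * s * k) * (L2_norm S \<eta> * L2_norm S (divg S v))"
      using abs_L2_inner_le[OF \<eta> divg_L2[OF v]] \<beta> k by (intro mult_left_mono) (auto simp: s(2))
    finally show ?thesis by (simp add: E_def D_def ac_simps)
  qed
  moreover have "\<beta> / \<epsilon>\<^sup>2 * L2_inner S \<eta> w \<le> E \<eta> * E w"
  proof -
    have "(s * s) * L2_inner S \<eta> w \<le> (s * s) * (L2_norm S \<eta> * L2_norm S w)"
      using abs_L2_inner_le[OF \<eta> w] by (intro mult_left_mono) auto
    then show ?thesis by (simp add: s(2)[symmetric] E_def ac_simps)
  qed
  moreover have "\<beta> * k / \<epsilon>\<^sup>2 * L2_inner S (divg S u) w \<le> D u * E w"
  proof -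
    have "\<beta> * k / \<epsilon>\<^sup>2 * L2_inner S (divg S u) w = (s * s * k) * L2_inner S (divg S u) w"
      by (simp add: s(2))
    also have "\<dots> \<le> (s * s * k) * (L2_norm S (divg S u) * L2_norm S w)"
      using abs_L2_inner_le[OF divg_L2[OF u] w] \<beta> k by (intro mult_left_mono) (auto simp: s(2))
    finally show ?thesis by (simp add: E_def D_def ac_simps)
  qed
  ultimately have "bilin_form S \<beta> H f C \<epsilon> k (u, \<eta>) (v, w)
      \<le> P u * P v + k / \<epsilon> * (P u * P v) + E \<eta> * D v + Q u * Q v + E \<eta> * E w + D u * E w"
    unfolding bilin_form.simps by linarith
  also have "\<dots> \<le> 2 * weighted_norm S \<beta> H C \<epsilon> k (u, \<eta>) * weighted_norm S \<beta> H C \<epsilon> k (v, w)"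
    unfolding norm[OF vL2(1)] norm[OF vL2(2)]
    \<comment> \<open>Here \<open>r\<close> is k/\<epsilon>, and \<open>r \<le> 1\<close> is the
      smallness condition on \<open>k\<close>.\<close>
    by (rule combined_bound) (use P0 Q0 L0 s k eps in \<open>auto simp: D_def E_def\<close>)
  finally show ?thesis .
qed

text \<open>Allows 2 to be replaced by any larger \<open>M\<close>. As \<open>sqrt\<close> is
  negative on negative reals, the radicand must be shown to be nonnegative.\<close>

lemma weighted_norm_nonneg:
  fixes S :: "('p, 'i) surface"
  assumes S: "oriented_riemannian_surface S" and "0 \<le> \<beta>" "0 \<le> k"
    and H: "\<And>p. p \<in> points S \<Longrightarrow> 0 \<le> H p" and C: "\<And>p. p \<in> points S \<Longrightarrow> 0 \<le> C p"
  shows "0 \<le> weighted_norm S \<beta> H C \<epsilon> k U"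
proof (cases U)
  case (Pair u \<eta>)
  have "0 \<le> vL2_inner S (vscale (\<lambda>p. (1 + C p * k) / H p) u) u"
    unfolding vL2_inner_def tinner_vscale_left
    using assms tinner_nonneg[OF S] by (intro integral_nonneg_AE AE_I2) (auto simp: space_leb[OF S])
  then show ?thesis
    using assms Pair by simp
qed

theorem corollary3p1:
  fixes S :: "('p, 'i) surface"
    and \<beta> H_star C_star :: real
    and H f C :: "'p \<Rightarrow> real"
  assumes "oriented_riemannian_surface S"
    and "\<beta> > 0"
    and "H \<in> borel_measurable (leb S)"
    and "f \<in> borel_measurable (leb S)"
    and "C \<in> borel_measurable (leb S)"
    and "H_star > 0"
    and "\<And>p. p \<in> points S \<Longrightarrow> H p \<ge> H_star"
    and "\<And>p. p \<in> points S \<Longrightarrow> \<bar>f p\<bar> \<le> 1"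
    and "\<And>p. p \<in> points S \<Longrightarrow> 0 \<le> C p \<and> C p \<le> C_star"
  shows "\<forall>M::real. M \<ge> 2 \<longrightarrow> (\<forall>\<epsilon>::real. \<epsilon> > 0 \<longrightarrow>
    (\<exists>k0>0. \<forall>k::real. 0 < k \<and> k \<le> k0 \<longrightarrow>
      (\<forall>U \<in> Hdiv S \<times> L2 S. \<forall>V \<in> Hdiv S \<times> L2 S.
        bilin_form S \<beta> H f C \<epsilon> k U V
          \<le> M * weighted_norm S \<beta> H C \<epsilon> k U * weighted_norm S \<beta> H C \<epsilon> k V)))"
proof (intro allI impI)
  fix M \<epsilon> :: real
  assume M: "M \<ge> 2" and eps: "\<epsilon> > 0"
  show "\<exists>k0>0. \<forall>k. 0 < k \<and> k \<le> k0 \<longrightarrow>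
      (\<forall>U \<in> Hdiv S \<times> L2 S. \<forall>V \<in> Hdiv S \<times> L2 S.
        bilin_form S \<beta> H f C \<epsilon> k U V
          \<le> M * weighted_norm S \<beta> H C \<epsilon> k U * weighted_norm S \<beta> H C \<epsilon> k V)"
  proof (rule exI[of _ \<epsilon>], rule conjI[OF eps], intro allI impI ballI)
    fix k U V
    assume k: "0 < k \<and> k \<le> \<epsilon>" and U: "U \<in> Hdiv S \<times> L2 S" and V: "V \<in> Hdiv S \<times> L2 S"
    have nonneg: "0 \<le> weighted_norm S \<beta> H C \<epsilon> k W" for W
    proof (rule weighted_norm_nonneg[OF assms(1)])
      show "0 \<le> \<beta>" "0 \<le> k" using assms(2) k by simp_all
      show "0 \<le> H p" if "p \<in> points S" for p
        using assms(6) assms(7)[OF that] by linarith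
      show "0 \<le> C p" if "p \<in> points S" for p
        using assms(9)[OF that] by simp
    qed
    have "bilin_form S \<beta> H f C \<epsilon> k (fst U, snd U) (fst V, snd V)
        \<le> 2 * weighted_norm S \<beta> H C \<epsilon> k (fst U, snd U) * weighted_norm S \<beta> H C \<epsilon> k (fst V, snd V)"
      by (rule bilin_form_le[OF assms(1,2) _ _ assms(3,5,6,7,8,9)])
         (use k U V in \<open>simp_all only: mem_Times_iff\<close>)
    then have "bilin_form S \<beta> H f C \<epsilon> k U V
        \<le> 2 * weighted_norm S \<beta> H C \<epsilon> k U * weighted_norm S \<beta> H C \<epsilon> k V"
      unfolding prod.collapse .
    also have "\<dots> \<le> M * weighted_norm S \<beta> H C \<epsilon> k U * weighted_norm S \<beta> H C \<epsilon> k V"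
      by (intro mult_right_mono M nonneg)
    finally show "bilin_form S \<beta> H f C \<epsilon> k U V
        \<le> M * weighted_norm S \<beta> H C \<epsilon> k U * weighted_norm S \<beta> H C \<epsilon> k V" .
  qed
qed

end
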